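(* Let $\alpha,\beta,\delta\in\mathbb{R}$ with $(\alpha,\beta)\neq(0,0)$ and let $\Gamma=\{(x,y)\in\mathbb{R}^2:\alpha x+\beta y+\delta=0\}$ be a line. Let $a,b,c$ be constants and let $u$ be any solution in $\mathbb{R}^2$ of $$\Delta u+a u_x+b u_y+cu=0$$ vanishing on $\Gamma$. Then for every $P=(x_0,y_0)\in\mathbb{R}^2$, $$u(P)=-\exp\Bigl(-\frac{(\alpha x_0+\beta y_0+\delta)(a\alpha+b\beta)}{\alpha^2+\beta^2}\Bigr)u(Q),$$ where $Q$ is the mirror image of $P$ with respect to the line $\Gamma$.
   Context: $Q=R(P)$ where $R(z)=\overline{S(z)}$ and $S$ is the Schwarz function of $\Gamma$ (the holomorphic function with $S(z)=\bar z$ on $\Gamma$); for a line this is the orthogonal reflection across $\Gamma$. *)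

theory Defs
  imports "HOL-Complex_Analysis.Complex_Analysis"
begin

definition dx :: "(real \<times> real \<Rightarrow> real) \<Rightarrow> real \<times> real \<Rightarrow> real" where
  "dx f = (\<lambda>(x, y). deriv (\<lambda>t. f (t, y)) x)"

definition dy :: "(real \<times> real \<Rightarrow> real) \<Rightarrow> real \<times> real \<Rightarrow> real" where
  "dy f = (\<lambda>(x, y). deriv (\<lambda>t. f (x, t)) y)"

text \<open>Since \<^const>\<open>deriv\<close> is total, existence of the partial derivatives is required
  explicitly. Continuity and total differentiability of \<open>f\<close> itself follow.\<close>

definition C1_plane :: "(real \<times> real \<Rightarrow> real) \<Rightarrow> bool" where
  "C1_plane f \<longleftrightarrow>
     (\<forall>x y. (\<lambda>t. f (t, y)) differentiable at x \<and> (\<lambda>t. f (x, t)) differentiable at y) \<and>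
     continuous_on UNIV (dx f) \<and> continuous_on UNIV (dy f)"

definition C2_plane :: "(real \<times> real \<Rightarrow> real) \<Rightarrow> bool" where
  "C2_plane f \<longleftrightarrow> C1_plane f \<and> C1_plane (dx f) \<and> C1_plane (dy f)"

definition laplacian :: "(real \<times> real \<Rightarrow> real) \<Rightarrow> real \<times> real \<Rightarrow> real" where
  "laplacian f P = dx (dx f) P + dy (dy f) P"

text \<open>Solutions are understood in the classical sense.\<close>

definition solution_on_plane ::
    "real \<Rightarrow> real \<Rightarrow> real \<Rightarrow> (real \<times> real \<Rightarrow> real) \<Rightarrow> bool" where
  "solution_on_plane a b c u \<longleftrightarrow>
     C2_plane u \<and> (\<forall>P. laplacian u P + a * dx u P + b * dy u P + c * u P = 0)"

text \<open>Orthogonal reflection across a line \<open>L\<close>: the foot of the perpendicular from \<open>P\<close> is the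
  point of \<open>L\<close> closest to \<open>P\<close>, and it is the midpoint of \<open>P\<close> and its mirror image.\<close>

definition mirror_image :: "(real \<times> real) set \<Rightarrow> real \<times> real \<Rightarrow> real \<times> real" where
  "mirror_image L P = 2 *\<^sub>R closest_point L P - P"

lemma mirror_image_line:
  fixes \<alpha> \<beta> \<delta> x y :: real
  assumes "(\<alpha>, \<beta>) \<noteq> (0, 0)"
  defines "k \<equiv> (\<alpha> * x + \<beta> * y + \<delta>) / (\<alpha>\<^sup>2 + \<beta>\<^sup>2)"
  shows "mirror_image {(x, y). \<alpha> * x + \<beta> * y + \<delta> = 0} (x, y) =
           (x - 2 * k * \<alpha>, y - 2 * k * \<beta>)"
proof -
  let ?L = "{(x, y). \<alpha> * x + \<beta> * y + \<delta> = 0}"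
  let ?F = "(x - k * \<alpha>, y - k * \<beta>)"
  have pos: "\<alpha>\<^sup>2 + \<beta>\<^sup>2 > 0" using assms(1) by (auto simp: sum_power2_gt_zero_iff)
  have k: "k * (\<alpha>\<^sup>2 + \<beta>\<^sup>2) = \<alpha> * x + \<beta> * y + \<delta>"
    using less_imp_neq[OF pos] by (simp add: k_def del: sum_power2_eq_zero_iff)
  have L: "?L = {p. (\<alpha>, \<beta>) \<bullet> p = - \<delta>}"
    by (auto simp: inner_prod_def)
  have F: "?F \<in> ?L"
    using k by (simp add: algebra_simps power2_eq_square)
  have cl: "closed ?L" and cv: "convex ?L"
    unfolding L by (rule closed_hyperplane, rule convex_hyperplane)
  have min: "dist (x, y) ?F \<le> dist (x, y) q" if "q \<in> ?L" for q
  proof -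
    obtain s t where q: "q = (s, t)" by (cases q)
    have e: "\<alpha> * (x - s) + \<beta> * (y - t) = k * (\<alpha>\<^sup>2 + \<beta>\<^sup>2)"
      using that k by (simp add: q algebra_simps)
    have "(x - s)\<^sup>2 + (y - t)\<^sup>2 - ((k * \<alpha>)\<^sup>2 + (k * \<beta>)\<^sup>2) =
        (x - s - k * \<alpha>)\<^sup>2 + (y - t - k * \<beta>)\<^sup>2
        + 2 * k * (\<alpha> * (x - s) + \<beta> * (y - t) - k * (\<alpha>\<^sup>2 + \<beta>\<^sup>2))"
      by (simp add: algebra_simps power2_eq_square)
    also have "\<dots> \<ge> 0" using e by simp
    finally show ?thesis by (simp add: q dist_Pair_Pair dist_real_def)
  qed
  have "?F = closest_point ?L (x, y)"
    by (rule closest_point_unique[OF cv cl F]) (use min in blast)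
  then show ?thesis
    by (simp add: mirror_image_def flip: \<open>?F = closest_point ?L (x, y)\<close>)
qed

text \<open>Agreement with the Schwarz-function reflection \<open>R z = cnj (S z)\<close>, where \<open>S\<close> is
  holomorphic near the line and equals \<open>cnj\<close> on it.\<close>

lemma mirror_image_schwarz:
  fixes \<alpha> \<beta> \<delta> :: real and S :: "complex \<Rightarrow> complex"
  assumes nz: "(\<alpha>, \<beta>) \<noteq> (0, 0)"
    and U: "open U" "connected U" "S holomorphic_on U"
    and sub: "\<And>z. \<alpha> * Re z + \<beta> * Im z + \<delta> = 0 \<Longrightarrow> z \<in> U"
    and S: "\<And>z. \<alpha> * Re z + \<beta> * Im z + \<delta> = 0 \<Longrightarrow> S z = cnj z"
    and P: "Complex x y \<in> U"
  shows "mirror_image {(x, y). \<alpha> * x + \<beta> * y + \<delta> = 0} (x, y) =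
           (Re (cnj (S (Complex x y))), Im (cnj (S (Complex x y))))"
proof -
  define w where "w = Complex \<alpha> \<beta>"
  define T where "T = (\<lambda>z. - (cnj w * z + 2 * of_real \<delta>) / w)"
  define L where "L = {z. \<alpha> * Re z + \<beta> * Im z + \<delta> = 0}"
  have pos: "\<alpha>\<^sup>2 + \<beta>\<^sup>2 > 0" using nz by (auto simp: sum_power2_gt_zero_iff)
  have w: "w \<noteq> 0" using nz by (auto simp: w_def complex_eq_iff)
  have TL: "T z = cnj z" if "z \<in> L" for z
  proof -
    have "\<delta> = - (\<alpha> * Re z + \<beta> * Im z)" using that by (simp add: L_def)
    then have "- (cnj w * z + 2 * of_real \<delta>) = cnj z * w"
      by (simp add: w_def complex_eq_iff algebra_simps)
    then show ?thesis using w by (simp add: T_def)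
  qed
  define f where "f = (\<lambda>t::real. of_real (- \<delta> / (\<alpha>\<^sup>2 + \<beta>\<^sup>2)) * w + of_real t * (\<i> * w))"
  have fL: "f t \<in> L" for t
  proof -
    have "\<alpha> * Re (f t) + \<beta> * Im (f t) = - \<delta> / (\<alpha>\<^sup>2 + \<beta>\<^sup>2) * (\<alpha>\<^sup>2 + \<beta>\<^sup>2)"
      by (simp add: f_def w_def power2_eq_square algebra_simps add_divide_distrib)
    also have "\<dots> = - \<delta>"
      using less_imp_neq[OF pos] by (simp del: sum_power2_eq_zero_iff)
    finally show ?thesis by (simp add: L_def)
  qed
  have "f 0 islimpt L"
    unfolding islimpt_approachable
  proof (intro allI impI)
    fix e :: real assume e: "e > 0"
    let ?t = "e / (2 * cmod w)"
    have "f ?t - f 0 = of_real ?t * (\<i> * w)" by (simp add: f_def)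
    then have "dist (f ?t) (f 0) = e / 2"
      using e w by (simp add: dist_norm norm_mult norm_divide)
    then show "\<exists>x'\<in>L. x' \<noteq> f 0 \<and> dist x' (f 0) < e"
      using e fL[of ?t] by (intro bexI[of _ "f ?t"]) auto
  qed
  moreover have "(\<lambda>z. S z - T z) holomorphic_on U"
    using w by (auto simp: T_def intro!: holomorphic_intros U)
  moreover have "L \<subseteq> U" "\<And>z. z \<in> L \<Longrightarrow> S z - T z = 0"
    using sub S TL by (auto simp: L_def)
  ultimately have "S (Complex x y) - T (Complex x y) = 0"
    using analytic_continuation[of "\<lambda>z. S z - T z" U L "f 0" "Complex x y"] U P fL by blast
  then have "S (Complex x y) = T (Complex x y)" by simp
  moreover have "cnj (T (Complex x y)) =
      Complex (x - 2 * ((\<alpha> * x + \<beta> * y + \<delta>) / (\<alpha>\<^sup>2 + \<beta>\<^sup>2)) * \<alpha>)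
              (y - 2 * ((\<alpha> * x + \<beta> * y + \<delta>) / (\<alpha>\<^sup>2 + \<beta>\<^sup>2)) * \<beta>)"
  proof -
    define k where "k = (\<alpha> * x + \<beta> * y + \<delta>) / (\<alpha>\<^sup>2 + \<beta>\<^sup>2)"
    have k: "\<delta> = k * (\<alpha>\<^sup>2 + \<beta>\<^sup>2) - \<alpha> * x - \<beta> * y"
      using less_imp_neq[OF pos] by (simp add: k_def del: sum_power2_eq_zero_iff)
    have "- (w * cnj (Complex x y) + 2 * of_real \<delta>) =
        Complex (x - 2 * k * \<alpha>) (y - 2 * k * \<beta>) * cnj w"
      unfolding k by (simp add: w_def complex_eq_iff algebra_simps power2_eq_square)
    then show ?thesis using w by (simp add: T_def k_def[symmetric])
  qed
  ultimately show ?thesis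
    unfolding mirror_image_line[OF nz] by simp
qed

end

theory Submission
  imports Defs
begin

text \<open>Rotating the line to the horizontal axis and multiplying by an exponential removes the first
  order terms, so that \<open>u\<close> becomes a solution \<open>v\<close> of \<open>\<Delta>v + l v = 0\<close> vanishing for \<open>y = 0\<close>, and the
  claim says that \<open>v\<close> is odd in \<open>y\<close>. The function \<open>w (x, y) = v (x, y) + v (x, -y)\<close> has zero Cauchy
  data on the axis, so the point is unique continuation for a merely \<open>C\<^sup>2\<close> solution. Let
  \<open>R z = (\<Sum>n. z^n / (n!)\<^sup>2)\<close>, which solves \<open>z R'' + R' = R\<close>, and \<open>K (y, t) = R (l (y\<^sup>2 - t\<^sup>2) / 4)\<close>, so
  that \<open>K\<^sub>y\<^sub>y - K\<^sub>t\<^sub>t = l K\<close> and \<open>K (y, y) = 1\<close>. Integrating by parts twice shows that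
  \<open>\<phi> (x, y) = \<integral>\<^sub>0\<^sup>y K (y, t) w (x, t) dt\<close> is harmonic. The entire function \<open>\<phi>\<^sub>x - i \<phi>\<^sub>y\<close> vanishes on the
  real axis, hence everywhere, so \<open>0 = \<phi>\<^sub>y = w + \<integral>\<^sub>0\<^sup>y K\<^sub>y w dt\<close>, a Volterra equation that forces
  \<open>w = 0\<close>.\<close>

section \<open>Differentiability from partial derivatives, and the Cauchy-Riemann equations\<close>

text \<open>The increment splits into a step in \<open>x\<close> at the base height and a step in
  \<open>y\<close> at a nearby abscissa. The mean value theorem and the continuity of
  \<open>f2\<close> control the second step.\<close>

lemma has_derivative_of_partials:
  fixes f f1 f2 :: "real \<times> real \<Rightarrow> real"
  assumes f1: "\<And>x y. ((\<lambda>t. f (t, y)) has_real_derivative f1 (x, y)) (at x)"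
    and f2: "\<And>x y. ((\<lambda>t. f (x, t)) has_real_derivative f2 (x, y)) (at y)"
    and cont: "continuous_on UNIV f2"
  shows "(f has_derivative (\<lambda>h. fst h * f1 p + snd h * f2 p)) (at p)"
proof -
  obtain x y where p: "p = (x, y)" by (cases p)
  have "((\<lambda>(x, y). f (x, y)) has_derivative
      (\<lambda>(tx, ty). f1 (x, y) * tx + blinfun_mult_right (f2 (x, y)) ty)) (at (x, y) within UNIV \<times> UNIV)"
  proof (rule has_derivative_partialsI[where fy = "\<lambda>x y. blinfun_mult_right (f2 (x, y))"])
    show "((\<lambda>x. f (x, y)) has_derivative (*) (f1 (x, y))) (at x within UNIV)"
      using f1 by (simp add: has_field_derivative_def)
    show "((\<lambda>y. f (x', y)) has_derivative blinfun_apply (blinfun_mult_right (f2 (x', y')))) (at y' within UNIV)"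
      for x' y'
      using f2 by (simp add: has_field_derivative_def)
    have "continuous_on UNIV (\<lambda>(x, y). blinfun_mult_right (f2 (x, y)))"
      unfolding split_beta prod.collapse
      by (rule bounded_linear.continuous_on[OF bounded_linear_blinfun_mult_right cont])
    then show "continuous (at (x, y) within UNIV \<times> UNIV) (\<lambda>(x, y). blinfun_mult_right (f2 (x, y)))"
      unfolding UNIV_Times_UNIV continuous_on_eq_continuous_within by blast
  qed auto
  then show ?thesis
    by (simp add: p case_prod_unfold mult.commute)
qed

lemma has_real_derivative_compose_pair:
  fixes f f1 f2 :: "real \<times> real \<Rightarrow> real"
  assumes f: "(f has_derivative (\<lambda>h. fst h * f1 (g t, k t) + snd h * f2 (g t, k t))) (at (g t, k t))"
    and g: "(g has_real_derivative g') (at t)"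
    and k: "(k has_real_derivative k') (at t)"
  shows "((\<lambda>t. f (g t, k t)) has_real_derivative g' * f1 (g t, k t) + k' * f2 (g t, k t)) (at t)"
proof -
  have "((\<lambda>t. (g t, k t)) has_derivative (\<lambda>h. (g' * h, k' * h))) (at t)"
    using g k by (auto simp: has_field_derivative_def intro: has_derivative_Pair)
  from has_derivative_compose[OF this, of f, OF f] show ?thesis
    unfolding has_field_derivative_def by (rule has_derivative_eq_rhs) (auto simp: algebra_simps)
qed

lemma Cauchy_Riemann_imp_has_field_derivative:
  fixes p p1 p2 q q1 q2 :: "real \<times> real \<Rightarrow> real"
  assumes p: "(p has_derivative (\<lambda>h. fst h * p1 (Re z, Im z) + snd h * p2 (Re z, Im z))) (at (Re z, Im z))"
    and q: "(q has_derivative (\<lambda>h. fst h * q1 (Re z, Im z) + snd h * q2 (Re z, Im z))) (at (Re z, Im z))"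
    and CR: "p1 (Re z, Im z) = q2 (Re z, Im z)" "p2 (Re z, Im z) = - q1 (Re z, Im z)"
  shows "((\<lambda>z. Complex (p (Re z, Im z)) (q (Re z, Im z))) has_field_derivative
    Complex (p1 (Re z, Im z)) (q1 (Re z, Im z))) (at z)"
proof -
  have c: "((\<lambda>z. (Re z, Im z)) has_derivative (\<lambda>h. (Re h, Im h))) (at z)"
    by (intro derivative_intros)
  have "((\<lambda>z. complex_of_real (p (Re z, Im z)) + \<i> * complex_of_real (q (Re z, Im z))) has_derivative
    (*) (Complex (p1 (Re z, Im z)) (q1 (Re z, Im z)))) (at z)"
    by (rule has_derivative_eq_rhs, (rule derivative_intros has_derivative_compose[OF c] p q)+)
      (auto simp: fun_eq_iff complex_eq_iff CR algebra_simps)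
  then show ?thesis
    by (simp add: has_field_derivative_def Complex_eq)
qed

section \<open>Volterra integrals and their derivatives\<close>

text \<open>This is \<open>\<integral>\<^sub>0\<^sup>y k (y, t) h (x, t) dt\<close>, with the usual sign when \<open>y\<close> is negative, substituted to
  a fixed interval.\<close>

definition volterra :: "(real \<times> real \<Rightarrow> real) \<Rightarrow> (real \<times> real \<Rightarrow> real) \<Rightarrow> real \<times> real \<Rightarrow> real" where
  "volterra k h = (\<lambda>(x, y). y * integral {0..1} (\<lambda>s. k (y, s * y) * h (x, s * y)))"

lemma continuous_on_compose_UNIV:
  assumes "continuous_on UNIV f" "continuous_on S g"
  shows "continuous_on S (\<lambda>x. f (g x))"
  using continuous_on_compose2[OF assms] by simp

lemma continuous_on_volterra:
  assumes k: "continuous_on UNIV k" and h: "continuous_on UNIV h"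
  shows "continuous_on UNIV (volterra k h)"
proof -
  have "continuous_on (UNIV \<times> cbox 0 1)
      (\<lambda>(p, s). k (snd p, s * snd p) * h (fst p, s * snd p))"
    unfolding split_beta
    by (intro continuous_intros continuous_on_compose_UNIV[OF k] continuous_on_compose_UNIV[OF h])
  from integral_continuous_on_param[OF this] show ?thesis
    unfolding volterra_def split_beta by (intro continuous_intros) simp
qed

lemma volterra_deriv_fst:
  assumes k: "continuous_on UNIV k" and h: "continuous_on UNIV h" and h1: "continuous_on UNIV h1"
    and d: "\<And>x y. ((\<lambda>t. h (t, y)) has_real_derivative h1 (x, y)) (at x)"
  shows "((\<lambda>t. volterra k h (t, y)) has_real_derivative volterra k h1 (x, y)) (at x)"
proof -
  have "((\<lambda>x. integral (cbox 0 1) (\<lambda>s. k (y, s * y) * h (x, s * y)))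
      has_field_derivative integral (cbox 0 1) (\<lambda>s. k (y, s * y) * h1 (x, s * y))) (at x within UNIV)"
    apply (rule leibniz_rule_field_derivative)
    subgoal using d by (auto intro!: DERIV_cmult)
    subgoal by (intro integrable_continuous continuous_intros continuous_on_compose_UNIV[OF k] continuous_on_compose_UNIV[OF h])
    subgoal unfolding split_beta by (intro continuous_intros continuous_on_compose_UNIV[OF k] continuous_on_compose_UNIV[OF h1])
    by auto
  then show ?thesis
    unfolding volterra_def by (auto intro!: DERIV_cmult)
qed

text \<open>The chain rule for \<open>F (s * y)\<close> in \<open>s\<close> gives the fundamental
  theorem of calculus on the segment from 0 to \<open>y\<close>, for either sign of
  \<open>y\<close>.\<close>

lemma integral_scaled_derivative:
  fixes F f :: "real \<Rightarrow> real"
  assumes "\<And>t. (F has_real_derivative f t) (at t)"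
  shows "((\<lambda>s. y * f (s * y)) has_integral F y - F 0) {0..1}"
proof -
  have "((\<lambda>s. y * f (s * y)) has_integral F (1 * y) - F (0 * y)) {0..1}"
  proof (rule fundamental_theorem_of_calculus)
    fix s :: real
    have "((\<lambda>s. F (s * y)) has_real_derivative f (s * y) * y) (at s)"
      by (rule DERIV_chain2[OF assms]) (auto intro!: derivative_eq_intros)
    then show "((\<lambda>s. F (s * y)) has_vector_derivative y * f (s * y)) (at s within {0..1})"
      by (simp add: mult.commute has_real_derivative_iff_has_vector_derivative has_vector_derivative_at_within)
  qed auto
  then show ?thesis by simp
qed

lemma scaled_integral_deriv:
  fixes f :: "real \<Rightarrow> real"
  assumes f: "continuous_on UNIV f"
  shows "((\<lambda>y. y * integral {0..1} (\<lambda>s. f (s * y))) has_real_derivative f y) (at y)"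
proof -
  \<comment> \<open>An antiderivative on the whole line covers negative \<open>y\<close> too; in
    terms of it the scaled integral is \<open>F y - F 0\<close>.\<close>
  obtain F where "\<And>t. (F has_vector_derivative f t) (at t)"
    using einterval_antiderivative[of "-\<infinity>" "\<infinity>" f] f
    by (auto simp: continuous_on_eq_continuous_at)
  then have F: "(F has_real_derivative f t) (at t)" for t
    by (simp add: has_real_derivative_iff_has_vector_derivative)
  have "y * integral {0..1} (\<lambda>s. f (s * y)) = F y - F 0" for y
    using integral_unique[OF integral_scaled_derivative[OF F, of y]] by simp
  then show ?thesis
    by (auto intro!: derivative_eq_intros F)
qed

text \<open>Differentiating the substituted integrand directly would also hit \<open>h\<close>
  through \<open>s * y\<close>. Treating the moving limit on its own turns that contribution into a
  boundary term and leaves the derivative on the kernel, so continuity of \<open>h\<close> is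
  enough.\<close>

lemma volterra_deriv_snd:
  assumes k: "continuous_on UNIV k" and h: "continuous_on UNIV h" and k1: "continuous_on UNIV k1"
    and d: "\<And>x y. ((\<lambda>t. k (t, y)) has_real_derivative k1 (x, y)) (at x)"
  shows "((\<lambda>t. volterra k h (x, t)) has_real_derivative k (y, y) * h (x, y) + volterra k1 h (x, y)) (at y)"
proof -
  define G where "G = (\<lambda>(y, z). z * integral {0..1} (\<lambda>s. k (y, s * z) * h (x, s * z)))"
  define G1 where "G1 = (\<lambda>(y, z). z * integral {0..1} (\<lambda>s. k1 (y, s * z) * h (x, s * z)))"
  have 1: "((\<lambda>t. G (t, z)) has_real_derivative G1 (y, z)) (at y)" for y z
  proof -
    have "((\<lambda>t. integral (cbox 0 1) (\<lambda>s. k (t, s * z) * h (x, s * z)))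
      has_field_derivative integral (cbox 0 1) (\<lambda>s. k1 (y, s * z) * h (x, s * z))) (at y within UNIV)"
      apply (rule leibniz_rule_field_derivative)
      subgoal using d by (auto intro!: DERIV_cmult_right)
      subgoal by (intro integrable_continuous continuous_intros continuous_on_compose_UNIV[OF k] continuous_on_compose_UNIV[OF h])
      subgoal unfolding split_beta by (intro continuous_intros continuous_on_compose_UNIV[OF k1] continuous_on_compose_UNIV[OF h])
      by auto
    then show ?thesis
      unfolding G_def G1_def by (auto intro!: DERIV_cmult)
  qed
  have 2: "((\<lambda>t. G (y, t)) has_real_derivative k (y, z) * h (x, z)) (at z)" for y z
    unfolding G_def prod.case
    by (rule scaled_integral_deriv)
      (intro continuous_intros continuous_on_compose_UNIV[OF k] continuous_on_compose_UNIV[OF h])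
  \<comment> \<open>\<open>G\<close> separates the two occurrences of \<open>y\<close>, in the kernel and in the limit of integration.\<close>
  have "((\<lambda>t. G (t, t)) has_real_derivative 1 * G1 (y, y) + 1 * (k (y, y) * h (x, y))) (at y)"
  proof (rule has_real_derivative_compose_pair[where ?f2.0 = "\<lambda>(y, z). k (y, z) * h (x, z)", simplified prod.case])
    have "continuous_on UNIV (\<lambda>(y, z). k (y, z) * h (x, z))"
      unfolding split_beta
      by (intro continuous_intros continuous_on_compose_UNIV[OF k] continuous_on_compose_UNIV[OF h])
    from has_derivative_of_partials[OF 1 _ this, of "(y, y)"] 2
    show "(G has_derivative (\<lambda>p. fst p * G1 (y, y) + snd p * (k (y, y) * h (x, y)))) (at (y, y))"
      by simp
  qed auto
  then show ?thesis
    by (simp add: G_def G1_def volterra_def add.commute)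
qed

section \<open>The power series behind the transmutation kernel\<close>

text \<open>For nonnegative \<open>z\<close> the witness is the Bessel function
  \<open>I_0 (2 * sqrt z)\<close>. Its differential equation is the coefficient recurrence
  \<open>c n = (n + 1)^2 * c (n + 1)\<close>.\<close>

lemma ex_transmutation_series:
  obtains R R1 R2 :: "real \<Rightarrow> real" where "R 0 = 1"
    and "\<And>z. (R has_real_derivative R1 z) (at z)" "\<And>z. (R1 has_real_derivative R2 z) (at z)"
    and "continuous_on UNIV R2" "\<And>z. z * R2 z + R1 z = R z"
proof -
  define c :: "nat \<Rightarrow> real" where "c n = 1 / (fact n)\<^sup>2" for n
  define S where "S = (\<lambda>c::nat \<Rightarrow> real. \<lambda>z::real. \<Sum>n. c n * z ^ n)"
  have c: "summable (\<lambda>n. c n * z ^ n)" for z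
  \<comment> \<open>Since \<open>(fact n)^2\<close> is at least \<open>fact n\<close>, the
    exponential series at \<open>norm z\<close> dominates.\<close>
  proof (rule summable_comparison_test')
    show "summable (\<lambda>n. norm z ^ n / fact n)"
      using summable_exp[of "norm z"] by (simp add: field_simps)
    show "norm (c n * z ^ n) \<le> norm z ^ n / fact n" if "n \<ge> 0" for n
    proof -
      have "c n \<le> 1 / fact n"
        unfolding c_def by (intro divide_left_mono self_le_power) (auto simp: fact_ge_1)
      then have "c n * norm z ^ n \<le> 1 / fact n * norm z ^ n"
        by (intro mult_right_mono) auto
      then show ?thesis by (simp add: norm_mult power_abs c_def)
    qed
  qed
  have diffs_summable: "summable (\<lambda>n. diffs d n * z ^ n)"
    if "\<And>z. summable (\<lambda>n. d n * z ^ n)" for d :: "nat \<Rightarrow> real" and z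
    using termdiff_converges_all[OF that] .
  note c1 = diffs_summable[OF c] and c2 = diffs_summable[OF diffs_summable[OF c]]
  have D: "(S d has_real_derivative S (diffs d) z) (at z)"
    if "\<And>z. summable (\<lambda>n. d n * z ^ n)" for d z
    unfolding S_def by (rule termdiffs_strong_converges_everywhere[OF that])
  have ode: "z * S (diffs (diffs c)) z + S (diffs c) z = S c z" for z
  proof -
    have "(\<lambda>n. z * (of_nat n * diffs c n * z ^ (n - Suc 0))) sums (z * S (diffs (diffs c)) z)"
      unfolding S_def by (rule sums_mult[OF diffs_equiv[OF c2]])
    moreover have "(\<lambda>n. diffs c n * z ^ n) sums S (diffs c) z"
      unfolding S_def by (rule summable_sums[OF c1])
    ultimately have "(\<lambda>n. z * (of_nat n * diffs c n * z ^ (n - Suc 0)) + diffs c n * z ^ n) sums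
        (z * S (diffs (diffs c)) z + S (diffs c) z)"
      by (rule sums_add)
    moreover have "z * (of_nat n * diffs c n * z ^ (n - Suc 0)) + diffs c n * z ^ n = c n * z ^ n" for n
    proof -
      \<comment> \<open>At \<open>n = 0\<close> the truncated exponent \<open>n - Suc 0\<close> does
        no harm, because the factor \<open>of_nat n\<close> vanishes.\<close>
      have 1: "z * (of_nat n * diffs c n * z ^ (n - Suc 0)) = of_nat n * diffs c n * z ^ n"
        by (cases n) auto
      \<comment> \<open>As \<open>diffs c n\<close> is \<open>Suc n * c (Suc n)\<close>, this is the
        recurrence with one factor \<open>Suc n\<close> absorbed into \<open>diffs\<close>.\<close>
      have 2: "c n = real (Suc n) * diffs c n"
        by (simp add: diffs_def c_def power2_eq_square divide_simps)
      show ?thesis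
        unfolding 1 unfolding 2 by (simp add: distrib_right)
    qed
    ultimately show ?thesis
      by (simp add: S_def sums_iff)
  qed
  show thesis
  proof (rule that[OF _ D[OF c] D[OF c1] _ ode])
    show "S c 0 = 1" unfolding S_def powser_zero by (simp add: c_def)
    show "continuous_on UNIV (S (diffs (diffs c)))"
      by (rule DERIV_continuous_on[OF has_field_derivative_at_within[OF D[OF c2]]])
  qed
qed

section \<open>Uniqueness for the homogeneous Volterra equation\<close>

text \<open>Each pass through \<open>h = - volterra k h\<close> improves the bound on
  \<open>h\<close>: integrating from 0 to \<open>t\<close> contributes a factor
  \<open>M * |t| / (n + 1)\<close>. The resulting bounds \<open>B * (M * |t|)^n / n!\<close> tend to
  0.\<close>

lemma volterra_fixpoint_eq_0:
  assumes k: "continuous_on UNIV k" and h: "continuous_on UNIV h"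
    and eq: "\<And>p. h p + volterra k h p = 0"
  shows "h (x, y) = 0"
proof -
  \<comment> \<open>The interval from \<open>- N\<close> to \<open>N\<close> contains
    \<open>s * t\<close> along with \<open>t\<close> for \<open>s\<close> between 0 and 1, so bounds
    \<open>B\<close> and \<open>M\<close> taken on it serve every iteration.\<close>
  define N where "N = \<bar>y\<bar>"
  have "compact ((\<lambda>t. h (x, t)) ` {-N..N})"
    by (intro compact_continuous_image continuous_intros continuous_on_compose_UNIV[OF h]) auto
  from compact_imp_bounded[OF this]
  obtain B where "\<forall>v\<in>(\<lambda>t. h (x, t)) ` {-N..N}. norm v \<le> B"
    unfolding bounded_iff by blast
  then have B: "\<bar>h (x, t)\<bar> \<le> B" if "t \<in> {-N..N}" for t
    using that by auto
  have "compact (k ` ({-N..N} \<times> {-N..N}))"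
    by (intro compact_continuous_image continuous_on_subset[OF k] compact_Times) auto
  from compact_imp_bounded[OF this]
  obtain M where "\<forall>v\<in>k ` ({-N..N} \<times> {-N..N}). norm v \<le> M"
    unfolding bounded_iff by blast
  then have M: "\<bar>k (t, s)\<bar> \<le> M" if "t \<in> {-N..N}" "s \<in> {-N..N}" for t s
    using that by auto
  have B0: "B \<ge> 0" using B[of 0] by (auto simp: N_def)
  have M0: "M \<ge> 0" using M[of 0 0] by (auto simp: N_def)
  have "\<bar>h (x, t)\<bar> \<le> B * ((M * \<bar>t\<bar>) ^ n / fact n)" if "\<bar>t\<bar> \<le> N" for t n
    using that
  proof (induction n arbitrary: t)
    case 0
    then show ?case using B[of t] by (simp add: abs_le_iff)
  next
    case (Suc n)
    let ?C = "M * (B * ((M * \<bar>t\<bar>) ^ n / fact n))"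
    \<comment> \<open>The integral of \<open>s ^ n\<close> supplies the factor
      \<open>1 / Suc n\<close> that turns \<open>fact n\<close> into \<open>fact (Suc n)\<close>;
      \<open>?C\<close> collects everything free of \<open>s\<close>.\<close>
    have "((\<lambda>s. ?C * s ^ n) has_integral ?C * (1 ^ Suc n / Suc n) - ?C * (0 ^ Suc n / Suc n)) {0..1}"
    proof (rule fundamental_theorem_of_calculus)
      fix s :: real
      have "((\<lambda>s. s ^ Suc n / Suc n) has_real_derivative s ^ n) (at s within {0..1})"
        by (rule derivative_eq_intros refl | simp)+
      from DERIV_cmult[OF this, of ?C]
      show "((\<lambda>s. ?C * (s ^ Suc n / Suc n)) has_vector_derivative ?C * s ^ n) (at s within {0..1})"
        by (simp add: has_real_derivative_iff_has_vector_derivative)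
    qed auto
    then have I: "((\<lambda>s. ?C * s ^ n) has_integral ?C / Suc n) {0..1}"
      by simp
    have "norm (integral {0..1} (\<lambda>s. k (t, s * t) * h (x, s * t))) \<le> integral {0..1} (\<lambda>s. ?C * s ^ n)"
    proof (rule integral_norm_bound_integral)
      show "(\<lambda>s. k (t, s * t) * h (x, s * t)) integrable_on {0..1}"
        by (intro integrable_continuous_interval continuous_intros
            continuous_on_compose_UNIV[OF k] continuous_on_compose_UNIV[OF h])
      show "(\<lambda>s. ?C * s ^ n) integrable_on {0..1}"
        using I by blast
      fix s :: real assume s: "s \<in> {0..1}"
      have st: "\<bar>s * t\<bar> \<le> N"
        using s Suc.prems mult_mono[of "\<bar>s\<bar>" 1 "\<bar>t\<bar>" N] by (simp add: abs_mult)
      have "\<bar>k (t, s * t)\<bar> * \<bar>h (x, s * t)\<bar> \<le> M * (B * ((M * \<bar>s * t\<bar>) ^ n / fact n))"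
        using st Suc.prems M0 by (intro mult_mono M Suc.IH) (auto simp: abs_le_iff)
      also have "\<dots> = ?C * s ^ n"
        using s by (simp add: abs_mult power_mult_distrib)
      finally show "norm (k (t, s * t) * h (x, s * t)) \<le> ?C * s ^ n"
        by (simp add: abs_mult)
    qed
    then have "\<bar>integral {0..1} (\<lambda>s. k (t, s * t) * h (x, s * t))\<bar> \<le> ?C / Suc n"
      using integral_unique[OF I] by simp
    then have "\<bar>t\<bar> * \<bar>integral {0..1} (\<lambda>s. k (t, s * t) * h (x, s * t))\<bar> \<le> \<bar>t\<bar> * (?C / Suc n)"
      by (rule mult_left_mono) auto
    also have "\<dots> = B * ((M * \<bar>t\<bar>) ^ Suc n / fact (Suc n))"
      by (simp add: field_simps)
    finally have "\<bar>t * integral {0..1} (\<lambda>s. k (t, s * t) * h (x, s * t))\<bar> \<le> B * ((M * \<bar>t\<bar>) ^ Suc n / fact (Suc n))"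
      unfolding abs_mult .
    moreover have "h (x, t) = - (t * integral {0..1} (\<lambda>s. k (t, s * t) * h (x, s * t)))"
      using eq[of "(x, t)"] by (simp add: volterra_def eq_neg_iff_add_eq_0)
    ultimately show ?case
      by (simp only: abs_minus_cancel)
  qed
  then have "\<bar>h (x, y)\<bar> \<le> B * ((M * \<bar>y\<bar>) ^ n / fact n)" for n
    by (simp add: N_def)
  moreover have lim: "(\<lambda>n. B * ((M * \<bar>y\<bar>) ^ n / fact n)) \<longlonglongrightarrow> B * 0"
    using summable_LIMSEQ_zero[OF summable_exp[of "M * \<bar>y\<bar>"]]
    by (intro tendsto_intros) (simp add: field_simps)
  ultimately have "\<bar>h (x, y)\<bar> \<le> 0"
    using LIMSEQ_le_const[OF lim, of "\<bar>h (x, y)\<bar>"] by auto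
  then show ?thesis by simp
qed

section \<open>Unique continuation and odd reflection for the Helmholtz equation\<close>

text \<open>The derivatives are parameters, so that the even part of a solution and the rotated,
  rescaled \<open>u\<close> can be instantiated with closed formulas.\<close>

locale helmholtz_solution =
  fixes l :: real and w w1 w2 w11 w22 :: "real \<times> real \<Rightarrow> real"
  assumes d1: "((\<lambda>t. w (t, y)) has_real_derivative w1 (x, y)) (at x)"
    and d2: "((\<lambda>t. w (x, t)) has_real_derivative w2 (x, y)) (at y)"
    and d11: "((\<lambda>t. w1 (t, y)) has_real_derivative w11 (x, y)) (at x)"
    and d22: "((\<lambda>t. w2 (x, t)) has_real_derivative w22 (x, y)) (at y)"
    and cont: "continuous_on UNIV w" "continuous_on UNIV w1" "continuous_on UNIV w2"
      "continuous_on UNIV w11" "continuous_on UNIV w22"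
    and helmholtz: "w11 p + w22 p + l * w p = 0"
begin

lemma zero_cauchy_data_imp_zero:
  assumes 0: "\<And>x. w (x, 0) = 0" "\<And>x. w2 (x, 0) = 0"
  shows "w p = 0"
proof -
  obtain R R1 R2 :: "real \<Rightarrow> real" where R0: "R 0 = 1"
    and R: "\<And>z. (R has_real_derivative R1 z) (at z)"
    and R1: "\<And>z. (R1 has_real_derivative R2 z) (at z)"
    and R2c: "continuous_on UNIV R2"
    and ode: "\<And>z. z * R2 z + R1 z = R z"
    by (rule ex_transmutation_series) blast
  have Rc: "continuous_on UNIV R" "continuous_on UNIV R1"
    using R R1 by (blast intro: DERIV_continuous_on has_field_derivative_at_within)+
  \<comment> \<open>The chain rule will give \<open>Kyy - Ktt = 4 * m * (r * R2 + R1)\<close>, which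
    the equation for \<open>R\<close> turns into \<open>4 * m * K\<close>; hence the quarter of
    \<open>l\<close>.\<close>
  define m where "m = l / 4"
  define r :: "real \<times> real \<Rightarrow> real" where "r = (\<lambda>(y, t). m * (y\<^sup>2 - t\<^sup>2))"
  define K where "K = (\<lambda>q. R (r q))"
  define Ky where "Ky = (\<lambda>q. 2 * m * fst q * R1 (r q))"
  define Kyy where "Kyy = (\<lambda>q. 2 * m * R1 (r q) + 4 * m\<^sup>2 * (fst q)\<^sup>2 * R2 (r q))"
  define Kt where "Kt = (\<lambda>q. - 2 * m * snd q * R1 (r q))"
  define Ktt where "Ktt = (\<lambda>q. - 2 * m * R1 (r q) + 4 * m\<^sup>2 * (snd q)\<^sup>2 * R2 (r q))"
  have rc: "continuous_on UNIV r"
    unfolding r_def split_beta by (intro continuous_intros)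
  have Kc: "continuous_on UNIV K" "continuous_on UNIV Ky" "continuous_on UNIV Kyy"
      "continuous_on UNIV Kt" "continuous_on UNIV Ktt"
    unfolding K_def Ky_def Kyy_def Kt_def Ktt_def
    by (intro continuous_intros continuous_on_compose_UNIV[OF Rc(1)]
        continuous_on_compose_UNIV[OF Rc(2)] continuous_on_compose_UNIV[OF R2c] rc)+
  have ry: "((\<lambda>y. r (y, t)) has_real_derivative 2 * m * y) (at y)"
    and rt: "((\<lambda>t. r (y, t)) has_real_derivative - 2 * m * t) (at t)" for y t
    by (auto simp: r_def intro!: derivative_eq_intros)
  have dKy: "((\<lambda>y. K (y, t)) has_real_derivative Ky (y, t)) (at y)"
    and dKyy: "((\<lambda>y. Ky (y, t)) has_real_derivative Kyy (y, t)) (at y)"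
    and dKt: "((\<lambda>t. K (y, t)) has_real_derivative Kt (y, t)) (at t)"
    and dKtt: "((\<lambda>t. Kt (y, t)) has_real_derivative Ktt (y, t)) (at t)" for y t
    unfolding K_def Ky_def Kyy_def Kt_def Ktt_def fst_conv snd_conv
    subgoal by (rule DERIV_cong[OF DERIV_chain2[OF R ry]]) simp
    subgoal by (rule DERIV_cong[OF DERIV_mult[OF DERIV_cmult[OF DERIV_ident] DERIV_chain2[OF R1 ry]]])
        (simp add: power2_eq_square algebra_simps)
    subgoal by (rule DERIV_cong[OF DERIV_chain2[OF R rt]]) simp
    subgoal by (rule DERIV_cong[OF DERIV_mult[OF DERIV_cmult[OF DERIV_ident] DERIV_chain2[OF R1 rt]]])
        (simp add: power2_eq_square algebra_simps)
    done
  have wave: "Kyy q = Ktt q + l * K q" for q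
  proof -
    have "Kyy q - Ktt q = 4 * m * (r q * R2 (r q) + R1 (r q))"
      by (cases q) (simp add: Kyy_def Ktt_def r_def algebra_simps power2_eq_square)
    then show ?thesis
      by (simp add: ode K_def m_def)
  qed
  have diag: "K (y, y) = 1" "Kt (y, y) = - Ky (y, y)" for y
    by (auto simp: K_def Kt_def Ky_def r_def R0)
  \<comment> \<open>For the potential \<open>volterra K w\<close>, the partial derivatives are
    \<open>volterra K w1\<close> and, as \<open>K\<close> is 1 on the diagonal,
    \<open>w + volterra Ky w\<close>. The next four facts differentiate these two once more.\<close>
  have dx1: "((\<lambda>t. volterra K w1 (t, y)) has_real_derivative volterra K w11 (x, y)) (at x)" for x y
    by (rule volterra_deriv_fst[OF Kc(1) cont(2) cont(4) d11])
  have dx2: "((\<lambda>t. volterra K w1 (x, t)) has_real_derivative w1 (x, y) + volterra Ky w1 (x, y)) (at y)" for x y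
    using volterra_deriv_snd[OF Kc(1) cont(2) Kc(2) dKy] by (simp add: diag)
  have dy1: "((\<lambda>t. w (t, y) + volterra Ky w (t, y)) has_real_derivative
      w1 (x, y) + volterra Ky w1 (x, y)) (at x)" for x y
    by (intro DERIV_add d1 volterra_deriv_fst[OF Kc(2) cont(1) cont(2) d1])
  have dy2: "((\<lambda>t. w (x, t) + volterra Ky w (x, t)) has_real_derivative
      w2 (x, y) + (Ky (y, y) * w (x, y) + volterra Kyy w (x, y))) (at y)" for x y
    by (intro DERIV_add d2 volterra_deriv_snd[OF Kc(2) cont(1) Kc(3) dKyy])
  have harmonic: "volterra K w11 (x, y) + (w2 (x, y) + (Ky (y, y) * w (x, y) + volterra Kyy w (x, y))) = 0" for x y
  proof -
    \<comment> \<open>This Lagrange bracket performs both integrations by parts at once. The zero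
      Cauchy data kill it at \<open>t = 0\<close>, and \<open>diag\<close> evaluates it at
      \<open>t = y\<close>.\<close>
    have "((\<lambda>t. Kt (y, t) * w (x, t) - K (y, t) * w2 (x, t)) has_real_derivative
        Ktt (y, t) * w (x, t) - K (y, t) * w22 (x, t)) (at t)" for t
      by (rule derivative_eq_intros refl dKt dKtt d2 d22 | simp add: algebra_simps)+
    from integral_scaled_derivative[OF this, of y]
    have "((\<lambda>s. y * (Ktt (y, s * y) * w (x, s * y) - K (y, s * y) * w22 (x, s * y))) has_integral
        - Ky (y, y) * w (x, y) - w2 (x, y)) {0..1}"
      by (simp add: 0 diag)
    \<comment> \<open>The terms with \<open>l\<close> from the kernel equation and from the
      Helmholtz equation cancel.\<close>
    moreover have "Ktt q * w p - K q * w22 p = Kyy q * w p + K q * w11 p" for p q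
    proof -
      have w22: "w22 p = - w11 p - l * w p" using helmholtz[of p] by linarith
      show ?thesis unfolding w22 wave by (simp add: algebra_simps)
    qed
    ultimately have "((\<lambda>s. y * (Kyy (y, s * y) * w (x, s * y) + K (y, s * y) * w11 (x, s * y))) has_integral
        - Ky (y, y) * w (x, y) - w2 (x, y)) {0..1}"
      by simp
    from integral_unique[OF this]
    have "- Ky (y, y) * w (x, y) - w2 (x, y) =
       y * integral {0..1} (\<lambda>s. Kyy (y, s * y) * w (x, s * y) + K (y, s * y) * w11 (x, s * y))"
      by simp
    also have "integral {0..1} (\<lambda>s. Kyy (y, s * y) * w (x, s * y) + K (y, s * y) * w11 (x, s * y)) =
      integral {0..1} (\<lambda>s. Kyy (y, s * y) * w (x, s * y)) + integral {0..1} (\<lambda>s. K (y, s * y) * w11 (x, s * y))"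
      by (intro integral_add integrable_continuous_interval continuous_intros
            continuous_on_compose_UNIV[OF Kc(1)] continuous_on_compose_UNIV[OF Kc(3)]
            continuous_on_compose_UNIV[OF cont(1)] continuous_on_compose_UNIV[OF cont(4)])
    finally show ?thesis
      by (simp add: volterra_def algebra_simps)
  qed
  define g where "g = (\<lambda>z. Complex (volterra K w1 (Re z, Im z)) (- (w (Re z, Im z) + volterra Ky w (Re z, Im z))))"
  have "g holomorphic_on UNIV"
    unfolding holomorphic_on_def field_differentiable_def
  proof
    fix z :: complex
    have "(g has_field_derivative Complex (volterra K w11 (Re z, Im z))
        (- (w1 (Re z, Im z) + volterra Ky w1 (Re z, Im z)))) (at z)"
      unfolding g_def
    \<comment> \<open>The first Cauchy-Riemann equation is \<open>harmonic\<close>; the second is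
      the agreement of the mixed derivatives in \<open>dx2\<close> and \<open>dy1\<close>.\<close>
    proof (rule Cauchy_Riemann_imp_has_field_derivative)
      show "(volterra K w1 has_derivative (\<lambda>h. fst h * volterra K w11 (Re z, Im z) +
          snd h * (\<lambda>p. w1 p + volterra Ky w1 p) (Re z, Im z))) (at (Re z, Im z))"
        by (rule has_derivative_of_partials[OF dx1 dx2])
          (intro continuous_intros cont continuous_on_volterra Kc)
      show "((\<lambda>p. - (w p + volterra Ky w p)) has_derivative
          (\<lambda>h. fst h * (\<lambda>p. - (w1 p + volterra Ky w1 p)) (Re z, Im z) +
            snd h * (\<lambda>(x, y). - (w2 (x, y) + (Ky (y, y) * w (x, y) + volterra Kyy w (x, y)))) (Re z, Im z)))
          (at (Re z, Im z))"
        by (rule has_derivative_of_partials)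
          (auto simp: split_beta simp del: minus_add_distrib intro!: DERIV_minus dy1 dy2 continuous_intros cont continuous_on_volterra Kc
            continuous_on_compose_UNIV[OF Kc(2)])
    qed (use harmonic[of "Re z" "Im z"] in \<open>auto simp: algebra_simps\<close>)
    then show "\<exists>f'. (g has_field_derivative f') (at z within UNIV)" by auto
  qed
  \<comment> \<open>On the axis the factor \<open>y\<close> in \<open>volterra\<close> is 0, and so
    is \<open>w\<close>.\<close>
  moreover have "g z = 0" if "z \<in> \<real>" for z
    using that by (auto simp: complex_is_Real_iff g_def volterra_def 0 complex_eq_iff)
  moreover have "(0 :: complex) islimpt \<real>"
    unfolding islimpt_approachable
  proof (intro allI impI)
    fix e :: real
    assume "e > 0"
    then show "\<exists>z\<in>\<real>. z \<noteq> 0 \<and> dist z (0 :: complex) < e"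
      by (intro bexI[of _ "of_real (e / 2)"]) (auto simp: norm_divide)
  qed
  ultimately have "g z = 0" for z
    using analytic_continuation[of g UNIV "\<real>" 0 z] by auto
  moreover have "w p + volterra Ky w p = - Im (g (Complex (fst p) (snd p)))" for p
    by (simp add: g_def)
  ultimately have "w p + volterra Ky w p = 0" for p
    by simp
  then show ?thesis
    using volterra_fixpoint_eq_0[OF Kc(2) cont(1)] by (metis surj_pair)
qed

text \<open>The equation is invariant under the sign change of \<open>y\<close>, so the even part is
  again a solution. On the axis its value vanishes by assumption and its normal derivative by
  evenness.\<close>

lemma odd_reflection:
  assumes "\<And>x. w (x, 0) = 0"
  shows "w (x, - y) = - w (x, y)"
proof -
  let ?r = "\<lambda>p::real \<times> real. (fst p, - snd p)"
  interpret even: helmholtz_solution l "\<lambda>p. w p + w (?r p)" "\<lambda>p. w1 p + w1 (?r p)"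
    "\<lambda>p. w2 p - w2 (?r p)" "\<lambda>p. w11 p + w11 (?r p)" "\<lambda>p. w22 p + w22 (?r p)"
  proof
    show "w11 p + w11 (?r p) + (w22 p + w22 (?r p)) + l * (w p + w (?r p)) = 0" for p
      using helmholtz[of p] helmholtz[of "?r p"] by (simp add: algebra_simps)
  next
    fix x y
    have neg: "((\<lambda>t. f (x, - t)) has_real_derivative - f' (x, - y)) (at y)"
      if "\<And>y. ((\<lambda>t. f (x, t)) has_real_derivative f' (x, y)) (at y)" for f f' :: "real \<times> real \<Rightarrow> real"
      using DERIV_chain2[where f = "\<lambda>t. f (x, t)" and g = uminus, OF that DERIV_minus[OF DERIV_ident]]
      by simp
    show "((\<lambda>t. w (t, y) + w (?r (t, y))) has_real_derivative w1 (x, y) + w1 (?r (x, y))) (at x)"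
      "((\<lambda>t. w1 (t, y) + w1 (?r (t, y))) has_real_derivative w11 (x, y) + w11 (?r (x, y))) (at x)"
      by (auto intro!: DERIV_add d1 d11)
    show "((\<lambda>t. w (x, t) + w (?r (x, t))) has_real_derivative w2 (x, y) - w2 (?r (x, y))) (at y)"
      using DERIV_add[OF d2 neg[OF d2]] by simp
    show "((\<lambda>t. w2 (x, t) - w2 (?r (x, t))) has_real_derivative w22 (x, y) + w22 (?r (x, y))) (at y)"
      using DERIV_diff[OF d22 neg[OF d22]] by simp
  qed (intro continuous_intros cont cont[THEN continuous_on_compose_UNIV])+
  show ?thesis
    using even.zero_cauchy_data_imp_zero[of "(x, y)"] assms by simp
qed

end

section \<open>Reduction of the general equation to the Helmholtz equation\<close>

lemma C1_plane_deriv: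
  assumes "C1_plane f"
  shows "((\<lambda>t. f (t, y)) has_real_derivative dx f (x, y)) (at x)"
    and "((\<lambda>t. f (x, t)) has_real_derivative dy f (x, y)) (at y)"
    and "(f has_derivative (\<lambda>h. fst h * dx f p + snd h * dy f p)) (at p)"
    and "continuous_on UNIV f"
proof -
  show 1: "((\<lambda>t. f (t, y)) has_real_derivative dx f (x, y)) (at x)" for x y
    using assms by (simp add: C1_plane_def dx_def DERIV_deriv_iff_real_differentiable)
  show 2: "((\<lambda>t. f (x, t)) has_real_derivative dy f (x, y)) (at y)" for x y
    using assms by (simp add: C1_plane_def dy_def DERIV_deriv_iff_real_differentiable)
  show 3: "(f has_derivative (\<lambda>h. fst h * dx f p + snd h * dy f p)) (at p)" for p
    using assms by (intro has_derivative_of_partials 1 2) (simp add: C1_plane_def)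
  show "continuous_on UNIV f"
    using has_derivative_at_withinI[OF 3] by (rule has_derivative_continuous_on)
qed

text \<open>The map \<open>g\<close> gives coordinates with origin \<open>p0\<close> and axes along
  \<open>(e1, e2)\<close> and \<open>(- e2, e1)\<close>. \<open>A\<close> and \<open>B\<close> are
  half the components of \<open>(a, b)\<close> in this frame, so the cross terms
  \<open>2 * A * us + 2 * B * ut\<close> produced by \<open>E\<close> are exactly the first order
  part of the equation. What remains is \<open>A^2 + B^2 = (a^2 + b^2) / 4\<close>, which is
  subtracted from \<open>c\<close>.\<close>

lemma helmholtz_solution_of_rotated:
  fixes a b c e1 e2 :: real and p0 :: "real \<times> real"
  assumes sol: "solution_on_plane a b c u" and unit: "e1\<^sup>2 + e2\<^sup>2 = 1"
  defines "A \<equiv> (a * e1 + b * e2) / 2" and "B \<equiv> (b * e1 - a * e2) / 2"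
  defines "g \<equiv> (\<lambda>p. (fst p0 + fst p * e1 - snd p * e2, snd p0 + fst p * e2 + snd p * e1))"
  defines "E \<equiv> (\<lambda>p. exp (A * fst p + B * snd p))"
  defines "us \<equiv> (\<lambda>p. e1 * dx u p + e2 * dy u p)" and "ut \<equiv> (\<lambda>p. e1 * dy u p - e2 * dx u p)"
  defines "uss \<equiv> (\<lambda>p. e1 * (e1 * dx (dx u) p + e2 * dx (dy u) p) + e2 * (e1 * dy (dx u) p + e2 * dy (dy u) p))"
    and "utt \<equiv> (\<lambda>p. e1 * (e1 * dy (dy u) p - e2 * dy (dx u) p) - e2 * (e1 * dx (dy u) p - e2 * dx (dx u) p))"
  shows "helmholtz_solution (c - (a\<^sup>2 + b\<^sup>2) / 4) (\<lambda>p. E p * u (g p))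
    (\<lambda>p. E p * (A * u (g p) + us (g p))) (\<lambda>p. E p * (B * u (g p) + ut (g p)))
    (\<lambda>p. E p * (A\<^sup>2 * u (g p) + 2 * A * us (g p) + uss (g p)))
    (\<lambda>p. E p * (B\<^sup>2 * u (g p) + 2 * B * ut (g p) + utt (g p)))"
proof -
  have C1: "C1_plane u" "C1_plane (dx u)" "C1_plane (dy u)"
    using sol by (auto simp: solution_on_plane_def C2_plane_def)
  note D = C1[THEN C1_plane_deriv(3)]
  have cont2: "continuous_on UNIV (dx (dx u))" "continuous_on UNIV (dy (dx u))"
      "continuous_on UNIV (dx (dy u))" "continuous_on UNIV (dy (dy u))"
    using C1 by (auto simp: C1_plane_def)
  note conts = C1[THEN C1_plane_deriv(4)] cont2
  have gc: "continuous_on UNIV g" and Ec: "continuous_on UNIV E"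
    unfolding g_def E_def by (intro continuous_intros)+
  have along: "((\<lambda>t. f (g (t, y))) has_real_derivative e1 * f1 (g (x, y)) + e2 * f2 (g (x, y))) (at x)"
      "((\<lambda>t. f (g (x, t))) has_real_derivative e1 * f2 (g (x, y)) - e2 * f1 (g (x, y))) (at y)"
    if "\<And>p. (f has_derivative (\<lambda>h. fst h * f1 p + snd h * f2 p)) (at p)" for f f1 f2 x y
    unfolding g_def fst_conv snd_conv
    using that
    by (auto intro!: derivative_eq_intros DERIV_cong[OF has_real_derivative_compose_pair[of f f1 _ _ _ f2]])
  have us: "(us has_derivative (\<lambda>h. fst h * (e1 * dx (dx u) p + e2 * dx (dy u) p)
      + snd h * (e1 * dy (dx u) p + e2 * dy (dy u) p))) (at p)" for p
    unfolding us_def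
    by (rule has_derivative_eq_rhs, (rule derivative_intros D)+) (auto simp: algebra_simps)
  have ut: "(ut has_derivative (\<lambda>h. fst h * (e1 * dx (dy u) p - e2 * dx (dx u) p)
      + snd h * (e1 * dy (dy u) p - e2 * dy (dx u) p))) (at p)" for p
    unfolding ut_def
    by (rule has_derivative_eq_rhs, (rule derivative_intros D)+) (auto simp: algebra_simps)
  have ds: "((\<lambda>t. u (g (t, y))) has_real_derivative us (g (x, y))) (at x)"
    and dt: "((\<lambda>t. u (g (x, t))) has_real_derivative ut (g (x, y))) (at y)"
    and dss: "((\<lambda>t. us (g (t, y))) has_real_derivative uss (g (x, y))) (at x)"
    and dtt: "((\<lambda>t. ut (g (x, t))) has_real_derivative utt (g (x, y))) (at y)" for x y
    unfolding uss_def utt_def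
    using along[OF D(1)] along[OF us] along[OF ut] by (simp_all add: us_def ut_def)
  have Es: "((\<lambda>t. E (t, y)) has_real_derivative A * E (x, y)) (at x)"
    and Et: "((\<lambda>t. E (x, t)) has_real_derivative B * E (x, y)) (at y)" for x y
    unfolding E_def by (auto intro!: derivative_eq_intros)
  show ?thesis
  proof
    fix p
    let ?q = "g p"
    \<comment> \<open>The mixed terms \<open>dx (dy u)\<close> and \<open>dy (dx u)\<close> each
      cancel between \<open>uss\<close> and \<open>utt\<close>, so symmetry of the second
      derivatives is not invoked.\<close>
    have 1: "uss ?q + utt ?q = (e1\<^sup>2 + e2\<^sup>2) * laplacian u ?q"
      by (simp add: uss_def utt_def laplacian_def algebra_simps power2_eq_square)
    have 2: "2 * A * us ?q + 2 * B * ut ?q = (e1\<^sup>2 + e2\<^sup>2) * (a * dx u ?q + b * dy u ?q)"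
      by (simp add: A_def B_def us_def ut_def field_simps power2_eq_square)
    have 3: "A\<^sup>2 + B\<^sup>2 = (e1\<^sup>2 + e2\<^sup>2) * (a\<^sup>2 + b\<^sup>2) / 4"
      by (simp add: A_def B_def field_simps power2_eq_square)
    have "laplacian u ?q + a * dx u ?q + b * dy u ?q + c * u ?q = 0"
      using sol unfolding solution_on_plane_def by blast
    then have "(A\<^sup>2 + B\<^sup>2) * u ?q + (2 * A * us ?q + 2 * B * ut ?q) + (uss ?q + utt ?q)
        + (c - (a\<^sup>2 + b\<^sup>2) / 4) * u ?q = 0"
      unfolding 1 2 3 unit by (simp add: algebra_simps)
    then have "E p * ((A\<^sup>2 + B\<^sup>2) * u ?q + (2 * A * us ?q + 2 * B * ut ?q) + (uss ?q + utt ?q)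
        + (c - (a\<^sup>2 + b\<^sup>2) / 4) * u ?q) = 0"
      by simp
    then show "E p * (A\<^sup>2 * u ?q + 2 * A * us ?q + uss ?q) + E p * (B\<^sup>2 * u ?q + 2 * B * ut ?q + utt ?q)
        + (c - (a\<^sup>2 + b\<^sup>2) / 4) * (E p * u ?q) = 0"
      by (simp add: algebra_simps)
  next
    fix x y
    show "((\<lambda>t. E (t, y) * u (g (t, y))) has_real_derivative
        E (x, y) * (A * u (g (x, y)) + us (g (x, y)))) (at x)"
      using DERIV_mult[OF Es[where x=x and y=y] ds[where x=x and y=y]] by (simp add: algebra_simps)
    show "((\<lambda>t. E (x, t) * u (g (x, t))) has_real_derivative
        E (x, y) * (B * u (g (x, y)) + ut (g (x, y)))) (at y)"
      using DERIV_mult[OF Et[where x=x and y=y] dt[where x=x and y=y]] by (simp add: algebra_simps)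
    show "((\<lambda>t. E (t, y) * (A * u (g (t, y)) + us (g (t, y)))) has_real_derivative
        E (x, y) * (A\<^sup>2 * u (g (x, y)) + 2 * A * us (g (x, y)) + uss (g (x, y)))) (at x)"
      using DERIV_mult[OF Es[where x=x and y=y]
        DERIV_add[OF DERIV_cmult[where c=A, OF ds[where x=x and y=y]] dss[where x=x and y=y]]]
      by (simp add: algebra_simps power2_eq_square)
    show "((\<lambda>t. E (x, t) * (B * u (g (x, t)) + ut (g (x, t)))) has_real_derivative
        E (x, y) * (B\<^sup>2 * u (g (x, y)) + 2 * B * ut (g (x, y)) + utt (g (x, y)))) (at y)"
      using DERIV_mult[OF Et[where x=x and y=y]
        DERIV_add[OF DERIV_cmult[where c=B, OF dt[where x=x and y=y]] dtt[where x=x and y=y]]]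
      by (simp add: algebra_simps power2_eq_square)
  qed (unfold us_def ut_def uss_def utt_def,
      (intro continuous_intros Ec conts[THEN continuous_on_compose_UNIV] gc)+)
qed

section \<open>The reflection formula for an arbitrary line\<close>

theorem theorem5p2:
  fixes \<alpha> \<beta> \<delta> a b c :: real
    and \<Gamma> :: "(real \<times> real) set"
    and u :: "real \<times> real \<Rightarrow> real"
  assumes "(\<alpha>, \<beta>) \<noteq> (0, 0)"
    and "\<Gamma> = {(x, y). \<alpha> * x + \<beta> * y + \<delta> = 0}"
    and "solution_on_plane a b c u"
    and "\<And>A. A \<in> \<Gamma> \<Longrightarrow> u A = 0"
  shows "\<forall>x0 y0. u (x0, y0) =
    - exp (- ((\<alpha> * x0 + \<beta> * y0 + \<delta>) * (a * \<alpha> + b * \<beta>) / (\<alpha>\<^sup>2 + \<beta>\<^sup>2)))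
      * u (mirror_image \<Gamma> (x0, y0))"
proof (intro allI)
  fix x0 y0 :: real
  define n where "n = sqrt (\<alpha>\<^sup>2 + \<beta>\<^sup>2)"
  have "\<alpha>\<^sup>2 + \<beta>\<^sup>2 > 0" using assms(1) by (auto simp: sum_power2_gt_zero_iff)
  then have n: "n > 0" and n2: "\<alpha>\<^sup>2 + \<beta>\<^sup>2 = n\<^sup>2"
    by (simp_all add: n_def)
  \<comment> \<open>The signed distance from P to the line is \<open>k * n\<close>, and
    \<open>p0\<close> below is the foot of the perpendicular.\<close>
  define k where "k = (\<alpha> * x0 + \<beta> * y0 + \<delta>) / n\<^sup>2"
  have k: "k * (\<alpha>\<^sup>2 + \<beta>\<^sup>2) = \<alpha> * x0 + \<beta> * y0 + \<delta>"
    using n by (simp add: k_def n2)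
  \<comment> \<open>This is the unit tangent whose quarter turn \<open>(- e2, e1)\<close> is the
    normal \<open>(\<alpha>, \<beta>) / n\<close>. Hence P and its mirror image have coordinates
    \<open>(0, k * n)\<close> and \<open>(0, - k * n)\<close>.\<close>
  define e1 e2 where "e1 = \<beta> / n" and "e2 = - \<alpha> / n"
  have unit: "e1\<^sup>2 + e2\<^sup>2 = 1"
    using n n2 by (simp add: e1_def e2_def power_divide add.commute flip: add_divide_distrib)
  define p0 where "p0 = (x0 - k * \<alpha>, y0 - k * \<beta>)"
  note odd = helmholtz_solution.odd_reflection[OF helmholtz_solution_of_rotated[OF assms(3) unit, of p0]]
  have line: "u (fst p0 + s * e1, snd p0 + s * e2) = 0" for s
  proof -
    have "\<alpha> * (x0 - k * \<alpha> + s * e1) + \<beta> * (y0 - k * \<beta> + s * e2) + \<delta> =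
        \<alpha> * x0 + \<beta> * y0 + \<delta> - k * (\<alpha>\<^sup>2 + \<beta>\<^sup>2)"
      by (simp add: e1_def e2_def algebra_simps power2_eq_square)
    then show ?thesis
      by (intro assms(4)) (simp add: assms(2) p0_def k)
  qed
  \<comment> \<open>\<open>T\<close> is the exponent of \<open>E\<close> at P, and
    \<open>- T\<close> the one at the mirror image; moving both factors to one side produces
    \<open>exp (- (2 * T))\<close>.\<close>
  define T where "T = k * (a * \<alpha> + b * \<beta>) / 2"
  have T: "(b * e1 - a * e2) * (k * n) / 2 = T" "k * n * e1 = k * \<beta>" "k * n * e2 = - (k * \<alpha>)"
    using n by (simp_all add: T_def e1_def e2_def field_simps)
  have "exp (- T) * u (x0 - 2 * k * \<alpha>, y0 - 2 * k * \<beta>) = - (exp T * u (x0, y0))"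
    using odd[of 0 "k * n"] line by (simp add: p0_def T) (simp add: mult_ac)
  then have "exp T * u (x0, y0) = - exp (- T) * u (x0 - 2 * k * \<alpha>, y0 - 2 * k * \<beta>)"
    by simp
  then have "exp (- T) * (exp T * u (x0, y0)) = exp (- T) * (- exp (- T) * u (x0 - 2 * k * \<alpha>, y0 - 2 * k * \<beta>))"
    by simp
  then have "u (x0, y0) = - exp (- (2 * T)) * u (x0 - 2 * k * \<alpha>, y0 - 2 * k * \<beta>)"
    by (simp add: mult.assoc[symmetric] flip: exp_add)
  moreover have "mirror_image \<Gamma> (x0, y0) = (x0 - 2 * k * \<alpha>, y0 - 2 * k * \<beta>)"
    using mirror_image_line[OF assms(1)] by (simp add: assms(2) k_def n2)
  moreover have "2 * T = (\<alpha> * x0 + \<beta> * y0 + \<delta>) * (a * \<alpha> + b * \<beta>) / (\<alpha>\<^sup>2 + \<beta>\<^sup>2)"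
    by (simp add: T_def k_def n2)
  ultimately show "u (x0, y0) =
    - exp (- ((\<alpha> * x0 + \<beta> * y0 + \<delta>) * (a * \<alpha> + b * \<beta>) / (\<alpha>\<^sup>2 + \<beta>\<^sup>2)))
      * u (mirror_image \<Gamma> (x0, y0))"
    by simp
qed

end
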